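(* For every $n\ge 1$, the complete graph $K_n$ is $132$-representable. Moreover, for $n\ge 3$, there are exactly $$2+C_{n-2}+\sum_{i=0}^{n}C_i$$ different $132$-representants for $K_n$, where $C_n=\frac{1}{n+1}\binom{2n}{n}$ is the $n$-th Catalan number. Finally, $K_1$ can be represented by a word of the form $11\cdots 1$, and $K_2$ can be represented by a word of the form $1212\cdots$ (of even or odd length) or $2121\cdots$ (of even or odd length).
   Context: All graphs are finite and simple, and $K_n$ denotes the complete graph on $n$ vertices, with vertices labelled $1,2,\ldots,n$ (with the usual order). For a finite word $w$, $A(w)$ is the set of letters occurring in $w$. Two distinct letters $x,y\in A(w)$ alternate in $w$ if deleting from $w$ all letters other than $x$ and $y$ leaves a word of the form $xyxy\cdots$ or $yxyx\cdots$ (of even or odd length). A word $w$ represents a graph $G=(V,E)$ if $A(w)=V$ (so every vertex occurs in $w$ at least once) and, for all $x\ne y$ in $V$, $x$ and $y$ alternate in $w$ if and only if $xy\in E$. A word $w=w_1\cdots w_m$ avoids the pattern $132$ (is $132$-avoiding) if there are no indices $i_1<i_2<i_3$ with $w_{i_1}<w_{i_3}<w_{i_2}$. A graph $G$ is $132$-representable if, possibly after relabelling its vertices by elements of a totally ordered set, there is a $132$-avoiding word that represents $G$; such a word is called a $132$-representant for $G$. For $K_n$, the $132$-representants are thus the $132$-avoiding words $w$ with $A(w)=\{1,\ldots,n\}$ in which every two distinct letters alternate, and they are counted as words. *)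

theory Defs
  imports Complex_Main
begin

text \<open>A graph is given by its vertex set \<open>V\<close> and its set \<open>E\<close> of ordered pairs of adjacent
  vertices; an undirected edge \<open>xy\<close> contributes both \<open>(x, y)\<close> and \<open>(y, x)\<close>.\<close>

definition simple_graph :: "'a set \<Rightarrow> 'a rel \<Rightarrow> bool" where
  "simple_graph V E \<longleftrightarrow> finite V \<and> E \<subseteq> V \<times> V \<and> sym E \<and> irrefl E"

definition K_verts :: "nat \<Rightarrow> nat set" where
  "K_verts n = {1..n}"

definition K_edges :: "nat \<Rightarrow> nat rel" where
  "K_edges n = {(x, y). x \<in> K_verts n \<and> y \<in> K_verts n \<and> x \<noteq> y}"

lemma simple_graph_K: "simple_graph (K_verts n) (K_edges n)"
  by (auto simp: simple_graph_def K_verts_def K_edges_def sym_def irrefl_def)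

text \<open>\<open>alt_word x y k\<close> is the word \<open>x y x y \<dots>\<close> with \<open>k\<close> letters.\<close>

fun alt_word :: "'a \<Rightarrow> 'a \<Rightarrow> nat \<Rightarrow> 'a list" where
  "alt_word x y 0 = []"
| "alt_word x y (Suc k) = x # alt_word y x k"

definition alternate :: "'a list \<Rightarrow> 'a \<Rightarrow> 'a \<Rightarrow> bool" where
  "alternate w x y \<longleftrightarrow> x \<in> set w \<and> y \<in> set w \<and> x \<noteq> y \<and>
     (\<exists>k. filter (\<lambda>z. z = x \<or> z = y) w = alt_word x y k \<or>
          filter (\<lambda>z. z = x \<or> z = y) w = alt_word y x k)"

definition represents :: "'a list \<Rightarrow> 'a set \<Rightarrow> 'a rel \<Rightarrow> bool" where
  "represents w V E \<longleftrightarrow> set w = V \<and>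
     (\<forall>x\<in>V. \<forall>y\<in>V. x \<noteq> y \<longrightarrow> (alternate w x y \<longleftrightarrow> (x, y) \<in> E))"

definition avoids_132 :: "'a::linorder list \<Rightarrow> bool" where
  "avoids_132 w \<longleftrightarrow>
     \<not> (\<exists>i j k. i < j \<and> j < k \<and> k < length w \<and> w ! i < w ! k \<and> w ! k < w ! j)"

text \<open>The words that are 132-representants of a graph whose vertices are already labelled by
  elements of a totally ordered type, with no further relabelling.\<close>

definition representants_132 :: "'a::linorder set \<Rightarrow> 'a rel \<Rightarrow> 'a list set" where
  "representants_132 V E = {w. avoids_132 w \<and> represents w V E}"

text \<open>Since graphs are finite, labels from an arbitrary totally ordered set can always be taken
  to be natural numbers; \<open>f\<close> is the relabelling.\<close>

definition representable_132 :: "'a set \<Rightarrow> 'a rel \<Rightarrow> bool" where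
  "representable_132 V E \<longleftrightarrow> simple_graph V E \<and>
     (\<exists>f :: 'a \<Rightarrow> nat. inj_on f V \<and> representants_132 (f ` V) (map_prod f f ` E) \<noteq> {})"

definition catalan :: "nat \<Rightarrow> real" where
  "catalan n = 1 / (real n + 1) * real ((2 * n) choose n)"

end

theory Submission
  imports Defs
begin

text \<open>If all letters of a word \<open>w\<close> alternate pairwise, then between two consecutive occurrences
  of a letter every other letter occurs exactly once. Hence \<open>w\<close> is a prefix of \<open>p p p \<dots>\<close>, where
  \<open>p\<close> lists the letters by first occurrence, and conversely every such prefix has this property
  (\<open>all_alternate_iff_cycle_word\<close>). The representants of \<open>K\<^sub>n\<close> of length \<open>n + j\<close> therefore
  correspond to the permutations \<open>p\<close> of \<open>1, \<dots>, n\<close> for which \<open>p\<close>, extended periodically by \<open>j\<close>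
  letters, still avoids 132.

  For \<open>n \<ge> 3\<close> the extensions die out quickly.
  \<^item> For \<open>j = 0\<close> they are the 132-avoiding permutations. Cutting at the maximum
    leaves two avoiding blocks, every letter of the left one above every letter of the right one.
    This gives the Catalan recurrence, so there are \<open>C\<^sub>n\<close> of them (\<open>card_avoiders_interval\<close>).
  \<^item> For \<open>j = 1\<close> the repeated first letter \<open>k\<close> forbids a smaller letter followed by a larger one,
    and its first occurrence forces the larger letters to increase. So \<open>p = k (k+1) \<dots> n \<sigma>\<close> with
    \<open>\<sigma>\<close> an avoiding permutation of \<open>1, \<dots>, k - 1\<close>, which gives \<open>C\<^sub>0 + \<dots> + C\<^bsub>n-1\<^esub>\<close>.
  \<^item> For \<open>j = 2\<close> the case \<open>k \<le> n - 2\<close> is killed by the subword \<open>k (k+2) (k+1)\<close>. All of \<open>k = n - 1\<close>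
    survives, giving \<open>C\<^bsub>n-2\<^esub>\<close>, and from \<open>k = n\<close> only \<open>p = n 1 2 \<dots> (n-1)\<close>.
  \<^item> For \<open>j = 3\<close> only \<open>p = (n-1) n 1 2 \<dots> (n-2)\<close> is left, and for \<open>j \<ge> 4\<close> nothing, since \<open>1 n 2\<close>
    has then appeared.

  A word in at most two letters contains no 132, so for \<open>n \<le> 2\<close> every periodic word
  of length at least \<open>n\<close> is a representant.\<close>

section \<open>Catalan numbers\<close>

lemma catalan_0 [simp]: "catalan 0 = 1"
  by (simp add: catalan_def)

lemma catalan_eq_fact: "catalan n = fact (2 * n) / ((real n + 1) * fact n * fact n)"
  unfolding catalan_def by (subst binomial_fact) (auto simp: mult_2)

lemma catalan_ratio: "(real n + 2) * catalan (Suc n) = 2 * (2 * real n + 1) * catalan n"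
proof -
  define x F f where "x = real n" "F = (fact (2 * n) :: real)" "f = (fact n :: real)"
  have pos: "x \<ge> 0" "f \<noteq> 0" by (simp_all add: x_F_f_def)
  have "catalan (Suc n) = (2 * x + 2) * (2 * x + 1) * F / ((x + 2) * ((x + 1) * f) * ((x + 1) * f))"
    unfolding catalan_eq_fact by (simp add: x_F_f_def algebra_simps)
  moreover have "catalan n = F / ((x + 1) * f * f)"
    by (simp add: catalan_eq_fact x_F_f_def)
  moreover have "(x + 2) * ((2 * x + 2) * (2 * x + 1) * F / ((x + 2) * ((x + 1) * f) * ((x + 1) * f)))
      = 2 * (2 * x + 1) * (F / ((x + 1) * f * f))"
  proof -
    have "2 * x + 2 = 2 * (x + 1)" by simp
    then show ?thesis using pos by (simp only:) (simp add: divide_simps, simp add: algebra_simps)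
  qed
  ultimately show ?thesis by (simp add: x_F_f_def(1))
qed

text \<open>Write \<open>S\<^sub>m\<close> for the convolution sum. Symmetry under \<open>i \<mapsto> m - i\<close> evaluates the
  sum weighted by \<open>i\<close> as \<open>m S\<^sub>m / 2\<close>. Summing the ratio law of consecutive Catalan numbers
  against \<open>C\<^bsub>n-i\<^esub>\<close> then relates \<open>S\<^bsub>n+1\<^esub>\<close> to \<open>S\<^sub>n\<close>, and the
  closed form satisfies the same relation; so induction proves the recurrence without generating
  functions.\<close>

lemma catalan_Suc: "catalan (Suc n) = (\<Sum>i\<le>n. catalan i * catalan (n - i))"
proof (induction n)
  case 0
  show ?case using catalan_ratio[of 0] by simp
next
  case (Suc n)
  define S where "S = (\<lambda>n. \<Sum>i\<le>n. catalan i * catalan (n - i))"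
  have weighted: "(\<Sum>i\<le>m. real i * (catalan i * catalan (m - i))) = real m / 2 * S m" for m
  proof -
    let ?T = "\<Sum>i\<le>m. real i * (catalan i * catalan (m - i))"
    have "?T = (\<Sum>i\<le>m. real (m - i) * (catalan (m - i) * catalan (m - (m - i))))"
      by (rule sum.nat_diff_reindex[symmetric, where n = "Suc m", simplified lessThan_Suc_atMost, simplified])
    also have "\<dots> = (\<Sum>i\<le>m. (real m - real i) * (catalan i * catalan (m - i)))"
      by (intro sum.cong) (auto simp: of_nat_diff)
    also have "\<dots> = real m * S m - ?T"
      by (simp add: S_def sum_subtractf left_diff_distrib sum_distrib_left)
    finally show ?thesis by simp
  qed
  have "(\<Sum>i\<le>n. (real i + 2) * catalan (Suc i) * catalan (n - i))
      = (\<Sum>i\<le>n. 4 * (real i * (catalan i * catalan (n - i))) + 2 * (catalan i * catalan (n - i)))"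
    by (intro sum.cong refl, unfold catalan_ratio) (simp add: algebra_simps)
  also have "\<dots> = (2 * real n + 2) * S n"
    unfolding sum.distrib sum_distrib_left[symmetric] weighted
    by (simp add: S_def algebra_simps)
  finally have lower: "(\<Sum>i\<le>n. (real i + 2) * catalan (Suc i) * catalan (n - i)) = (2 * real n + 2) * S n" .
  have "(real (Suc n) / 2 + 1) * S (Suc n)
      = (\<Sum>i\<le>Suc n. (real i + 1) * (catalan i * catalan (Suc n - i)))"
    using weighted[of "Suc n"]
    by (simp add: S_def distrib_right sum.distrib del: sum.atMost_Suc)
  also have "\<dots> = catalan (Suc n) + (\<Sum>i\<le>n. (real i + 2) * catalan (Suc i) * catalan (n - i))"
    by (subst sum.atMost_Suc_shift) (simp add: algebra_simps)
  also have "\<dots> = (2 * real n + 3) * catalan (Suc n)"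
    using Suc.IH lower by (simp add: S_def algebra_simps)
  also have "\<dots> = (real n + 3) / 2 * catalan (Suc (Suc n))"
    using catalan_ratio[of "Suc n"] by (simp add: algebra_simps)
  finally have "(real n + 3) * S (Suc n) = (real n + 3) * catalan (Suc (Suc n))"
    by (simp add: field_simps)
  then show ?case
    unfolding S_def by (smt (verit) mult_cancel_left of_nat_0_le_iff)
qed

section \<open>Avoiding 132\<close>

text \<open>The patterns that start with the first letter of a word, or in \<open>avoids_132_snoc\<close> end with
  its last letter, become conditions on pairs of the remaining letters. In the form of \<open>sorted_wrt\<close> these conditions
  decompose along concatenations.\<close>

lemma avoids_132_Cons:
  "avoids_132 (x # w) \<longleftrightarrow> avoids_132 w \<and> sorted_wrt (\<lambda>b c. \<not> (x < c \<and> c < b)) w"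
proof (intro iffI conjI)
  assume A: "avoids_132 (x # w)"
  show "avoids_132 w"
    unfolding avoids_132_def
  proof safe
    fix i j k assume "i < j" "j < k" "k < length w" "w ! i < w ! k" "w ! k < w ! j"
    moreover have "\<not> (Suc i < Suc j \<and> Suc j < Suc k \<and> Suc k < length (x # w) \<and>
        (x # w) ! Suc i < (x # w) ! Suc k \<and> (x # w) ! Suc k < (x # w) ! Suc j)"
      using A unfolding avoids_132_def by blast
    ultimately show False by simp
  qed
  show "sorted_wrt (\<lambda>b c. \<not> (x < c \<and> c < b)) w"
    unfolding sorted_wrt_iff_nth_less
  proof safe
    fix j k assume "j < k" "k < length w" "x < w ! k" "w ! k < w ! j"
    moreover have "\<not> (0 < Suc j \<and> Suc j < Suc k \<and> Suc k < length (x # w) \<and>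
        (x # w) ! 0 < (x # w) ! Suc k \<and> (x # w) ! Suc k < (x # w) ! Suc j)"
      using A unfolding avoids_132_def by blast
    ultimately show False by simp
  qed
next
  assume A: "avoids_132 w \<and> sorted_wrt (\<lambda>b c. \<not> (x < c \<and> c < b)) w"
  show "avoids_132 (x # w)"
    unfolding avoids_132_def
  proof safe
    fix i j k assume *: "i < j" "j < k" "k < length (x # w)"
      "(x # w) ! i < (x # w) ! k" "(x # w) ! k < (x # w) ! j"
    from *(1,2) obtain j' k' where jk: "j = Suc j'" "k = Suc k'"
      by (cases j; cases k) auto
    show False
    proof (cases i)
      case 0
      with * jk A show False by (auto simp: sorted_wrt_iff_nth_less)
    next
      case (Suc i')
      with * jk have "i' < j' \<and> j' < k' \<and> k' < length w \<and> w ! i' < w ! k' \<and> w ! k' < w ! j'" by simp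
      with A show False unfolding avoids_132_def by blast
    qed
  qed
qed

lemma avoids_132_Nil [simp]: "avoids_132 []"
  by (simp add: avoids_132_def)

lemma avoids_132_snoc:
  "avoids_132 (w @ [y]) \<longleftrightarrow> avoids_132 w \<and> sorted_wrt (\<lambda>a b. \<not> (a < y \<and> y < b)) w"
  by (induction w) (auto simp: avoids_132_Cons sorted_wrt_append)

lemma avoids_132_snoc_extremal:
  assumes "avoids_132 w" "(\<forall>b\<in>set w. b \<le> y) \<or> (\<forall>a\<in>set w. y \<le> a)"
  shows "avoids_132 (w @ [y])"
proof -
  have "sorted_wrt (\<lambda>a b. \<not> (a < y \<and> y < b)) w"
    unfolding sorted_wrt_iff_nth_less
    using assms(2) by (metis nth_mem not_le order.strict_trans)
  with assms(1) show ?thesis by (simp add: avoids_132_snoc)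
qed

lemma avoids_132_appendD: "avoids_132 (u @ v) \<Longrightarrow> avoids_132 u"
  by (induction u) (auto simp: avoids_132_Cons sorted_wrt_append)

lemma avoids_132_appendD2: "avoids_132 (u @ v) \<Longrightarrow> avoids_132 v"
  by (induction u) (auto simp: avoids_132_Cons)

text \<open>A 132 pattern has its first letter as the strict minimum, so it cannot start in a block
  and end in another one that lies weakly below.\<close>

lemma avoids_132_append_descending:
  assumes "\<And>a b. a \<in> set u \<Longrightarrow> b \<in> set v \<Longrightarrow> b \<le> a"
  shows "avoids_132 (u @ v) \<longleftrightarrow> avoids_132 u \<and> avoids_132 v"
  using assms
proof (induction u)
  case (Cons x u)
  have "sorted_wrt (\<lambda>b c. \<not> (x < c \<and> c < b)) v"
    using Cons.prems[of x] by (auto simp: sorted_wrt_iff_nth_less dest: nth_mem leD)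
  with Cons show ?case
    by (fastforce simp: avoids_132_Cons sorted_wrt_append)
qed simp

lemma avoids_132_sorted: "sorted w \<Longrightarrow> avoids_132 w"
  by (induction w) (auto simp: avoids_132_Cons elim!: sorted_wrt_mono_rel[rotated])

lemma not_avoids_132:
  assumes "a < c" "c < b" "w = u @ a # v @ b # x @ [c]"
  shows "\<not> avoids_132 w"
proof
  assume "avoids_132 w"
  then have "avoids_132 (a # v @ b # x @ [c])"
    using assms(3) avoids_132_appendD2 by blast
  then show False
    using assms(1,2) by (simp add: avoids_132_Cons sorted_wrt_append)
qed

definition avoiders :: "nat set \<Rightarrow> nat list set" where
  "avoiders S = {p. distinct p \<and> set p = S \<and> avoids_132 p}"

lemma finite_avoiders: "finite S \<Longrightarrow> finite (avoiders S)"
  by (rule finite_subset[OF _ finite_subset_distinct[of S]]) (auto simp: avoiders_def)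

text \<open>The letters before the maximum must all exceed those after it, because a smaller letter
  before it and a larger one after it would form 132 with it. So the split of the remaining
  letters is determined by the number \<open>k\<close> of letters after the maximum.\<close>

lemma avoiders_interval_Suc:
  "avoiders {a..<a + Suc n} =
     (\<Union>k\<le>n. (\<lambda>(l, r). l @ (a + n) # r) ` (avoiders {a + k..<a + n} \<times> avoiders {a..<a + k}))"
  (is "?L = ?R")
proof
  show "?R \<subseteq> ?L"
  proof clarify
    fix k l r assume k: "k \<le> n" and l: "l \<in> avoiders {a + k..<a + n}" and r: "r \<in> avoiders {a..<a + k}"
    have "avoids_132 (l @ [a + n])"
      using l by (intro avoids_132_snoc_extremal) (auto simp: avoiders_def)
    then have "avoids_132 ((l @ [a + n]) @ r)"
      using k l r by (subst avoids_132_append_descending) (auto simp: avoiders_def)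
    then show "l @ (a + n) # r \<in> ?L"
      using k l r by (auto simp: avoiders_def)
  qed
  show "?L \<subseteq> ?R"
  proof
    fix w assume w: "w \<in> ?L"
    then have "a + n \<in> set w" by (auto simp: avoiders_def)
    then obtain l r where lr: "w = l @ (a + n) # r" by (meson split_list)
    have un: "set l \<union> set r = {a..<a + n}" and dis: "set l \<inter> set r = {}" "distinct l" "distinct r"
    proof -
      have "insert (a + n) (set l \<union> set r) = {a..<a + Suc n}" "a + n \<notin> set l \<union> set r"
        using w lr by (auto simp: avoiders_def)
      then have "set l \<union> set r = {a..<a + Suc n} - {a + n}" by blast
      also have "{a..<a + Suc n} - {a + n} = {a..<a + n}" by auto
      finally show "set l \<union> set r = {a..<a + n}" .
      show "set l \<inter> set r = {}" "distinct l" "distinct r"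
        using w lr by (auto simp: avoiders_def)
    qed
    have av: "avoids_132 (l @ [a + n])" "avoids_132 r"
      using w lr avoids_132_appendD[of "l @ [a + n]" r] avoids_132_appendD2[of "l @ [a + n]" r]
      by (auto simp: avoiders_def)
    have desc: "y < x" if xy: "x \<in> set l" "y \<in> set r" for x y
    proof (rule ccontr)
      assume "\<not> y < x"
      with xy dis un have "x < y" "y < a + n"
        by (metis IntI empty_iff nat_neq_iff) (use xy un in auto)
      moreover obtain l1 l2 r1 r2 where "l = l1 @ x # l2" "r = r1 @ y # r2"
        using xy by (meson split_list)
      moreover have "avoids_132 (l @ (a + n) # r1 @ [y])"
        using w lr \<open>r = _\<close> avoids_132_appendD[of "l @ (a + n) # r1 @ [y]" r2] by (auto simp: avoiders_def)
      ultimately show False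
        using not_avoids_132[of x y "a + n" _ l1 l2 r1] by auto
    qed
    \<comment> \<open>As \<open>set r\<close> is downward closed in the interval, its first gap is where it ends.\<close>
    define b where "b = (LEAST b. a \<le> b \<and> b \<notin> set r)"
    have "a + n \<notin> set r" using un by auto
    then have b: "a \<le> b" "b \<notin> set r" "b \<le> a + n"
      unfolding b_def
      using LeastI[of "\<lambda>b. a \<le> b \<and> b \<notin> set r" "a + n"] Least_le[of "\<lambda>b. a \<le> b \<and> b \<notin> set r" "a + n"]
      by auto
    have "c \<in> set r" if "a \<le> c" "c < b" for c
      using that not_less_Least[of c "\<lambda>b. a \<le> b \<and> b \<notin> set r"] by (auto simp: b_def)
    moreover have "c < b" if c: "c \<in> set r" for c
    proof (rule ccontr)
      assume "\<not> c < b"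
      then have "b < c" using b c by (metis nat_neq_iff)
      moreover have "c < a + n" using c un by auto
      ultimately have "b \<in> set l" using b un by (metis UnE atLeastLessThan_iff order.strict_trans)
      then show False using desc[of b c] c \<open>b < c\<close> by simp
    qed
    moreover have "a \<le> c" if "c \<in> set r" for c
      using that un by (metis UnI2 atLeastLessThan_iff)
    ultimately have setr: "set r = {a..<b}" by (intro equalityI subsetI) auto
    have "set l = {a..<a + n} - {a..<b}" using un dis(1) setr by blast
    also have "\<dots> = {b..<a + n}" using b(1) by auto
    finally have setl: "set l = {b..<a + n}" .
    show "w \<in> ?R"
    proof (rule UN_I[of "b - a"])
      show "b - a \<in> {..n}" using b by simp
      have "(l, r) \<in> avoiders {a + (b - a)..<a + n} \<times> avoiders {a..<a + (b - a)}"
        using setl setr b(1) dis av avoids_132_appendD[of l] by (auto simp: avoiders_def)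
      then show "w \<in> (\<lambda>(l, r). l @ (a + n) # r) `
          (avoiders {a + (b - a)..<a + n} \<times> avoiders {a..<a + (b - a)})"
        using lr by force
    qed
  qed
qed

lemma card_avoiders_interval: "real (card (avoiders {a..<a + n})) = catalan n"
proof (induction n arbitrary: a rule: less_induct)
  case (less n)
  show ?case
  proof (cases n)
    case 0
    then have "avoiders {a..<a + n} = {[]}" by (auto simp: avoiders_def)
    then show ?thesis using 0 by simp
  next
    case (Suc m)
    let ?f = "\<lambda>(l, r). l @ (a + m) # r"
    let ?B = "\<lambda>k. avoiders {a + k..<a + m} \<times> avoiders {a..<a + k}"
    have inj: "inj_on ?f (\<Union>k\<le>m. ?B k)"
      by (auto simp: inj_on_def avoiders_def append_Cons_eq_iff)
    have "card (avoiders {a..<a + Suc m}) = card (\<Union>k\<le>m. ?B k)"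
      using inj unfolding avoiders_interval_Suc image_UN[symmetric] by (rule card_image)
    also have "\<dots> = (\<Sum>k\<le>m. card (?B k))"
    proof (rule card_UN_disjoint)
      show "\<forall>i\<in>{..m}. \<forall>j\<in>{..m}. i \<noteq> j \<longrightarrow> ?B i \<inter> ?B j = {}"
        by (auto simp: avoiders_def) (metis add_left_cancel atLeastLessThan_eq_iff add.right_neutral atLeastLessThan_empty_iff2 le_add1 less_le not_le)+
    qed (auto intro: finite_avoiders)
    also have "real \<dots> = (\<Sum>k\<le>m. catalan (m - k) * catalan k)"
      unfolding of_nat_sum
    proof (rule sum.cong)
      fix k assume "k \<in> {..m}"
      then show "real (card (?B k)) = catalan (m - k) * catalan k"
        using less[of "m - k" "a + k"] less[of k a] Suc by (simp add: card_cartesian_product)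
    qed simp
    finally show ?thesis
      using Suc by (simp add: catalan_Suc mult.commute)
  qed
qed

section \<open>Words in which all letters alternate\<close>

text \<open>The prefix of length \<open>m\<close> of \<open>p p p \<dots>\<close>. Recursion on the rotated list makes removing the
  first letter stay within words of the same kind.\<close>

fun cycle_word :: "'a list \<Rightarrow> nat \<Rightarrow> 'a list" where
  "cycle_word p 0 = []"
| "cycle_word p (Suc m) = hd p # cycle_word (rotate1 p) m"

lemma length_cycle_word [simp]: "length (cycle_word p m) = m"
  by (induction m arbitrary: p) auto

lemma set_cycle_word: "p \<noteq> [] \<Longrightarrow> set (cycle_word p m) \<subseteq> set p"
proof (induction m arbitrary: p)
  case (Suc m)
  then show ?case using Suc.IH[of "rotate1 p"] by auto
qed simp

lemma cycle_word_append: "cycle_word (u @ v) (length u + m) = u @ cycle_word (v @ u) m"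
  by (induction u arbitrary: v) auto

lemma cycle_word_ge: "cycle_word p (length p + m) = p @ cycle_word p m"
  using cycle_word_append[of p "[]" m] by simp

text \<open>Unlike \<open>alternate\<close>, this fixes which letter comes first and admits words in which a
  letter is missing; both are what an induction over the word requires.\<close>

definition alternates_from :: "'a list \<Rightarrow> 'a \<Rightarrow> 'a \<Rightarrow> bool" where
  "alternates_from w x y \<longleftrightarrow> (\<exists>k. filter (\<lambda>z. z = x \<or> z = y) w = alt_word x y k)"

lemma alternates_from_Nil [simp]: "alternates_from [] x y"
  by (auto simp: alternates_from_def intro: exI[of _ 0])

lemma alternates_from_Cons_same: "x \<noteq> y \<Longrightarrow> alternates_from (x # w) x y \<longleftrightarrow> alternates_from w y x"
proof -
  have "(\<exists>k. x # u = alt_word x y k) \<longleftrightarrow> (\<exists>k. u = alt_word y x k)" for u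
    by (metis alt_word.simps(2) alt_word.elims list.distinct(1) list.inject)
  then show ?thesis by (simp add: alternates_from_def disj_commute)
qed

lemma alternates_from_Cons_other:
  "z \<noteq> x \<Longrightarrow> z \<noteq> y \<Longrightarrow> alternates_from (z # w) x y \<longleftrightarrow> alternates_from w x y"
  by (simp add: alternates_from_def)

lemma alternates_from_Cons_second: "x \<noteq> y \<Longrightarrow> \<not> alternates_from (y # w) x y"
proof
  assume "x \<noteq> y" "alternates_from (y # w) x y"
  then obtain k u where "y # u = alt_word x y k" by (auto simp: alternates_from_def)
  with \<open>x \<noteq> y\<close> show False by (cases k) auto
qed

text \<open>The first letter of \<open>w\<close> must be the head of \<open>p\<close>, since the head precedes every other letter.
  After removing it, that letter has to wait for all others, so the remaining word obeys the same
  condition with \<open>p\<close> rotated.\<close>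

lemma sorted_wrt_alternates_from_iff:
  assumes "distinct p" "set w \<subseteq> set p"
  shows "sorted_wrt (alternates_from w) p \<longleftrightarrow> w = cycle_word p (length w)"
  using assms
proof (induction w arbitrary: p)
  case Nil
  have "sorted_wrt (\<lambda>_ _. True) p" by (induction p) auto
  then show ?case by simp
next
  case (Cons z w)
  then obtain x q where p: "p = x # q" by (cases p) auto
  show ?case
  proof (cases "z = x")
    case True
    have "sorted_wrt (alternates_from (x # w)) p \<longleftrightarrow> sorted_wrt (alternates_from w) (q @ [x])"
    proof -
      have "sorted_wrt (alternates_from (x # w)) q \<longleftrightarrow> sorted_wrt (alternates_from w) q"
      proof -
        have "alternates_from (x # w) a b = alternates_from w a b" if "a \<in> set q" "b \<in> set q" for a b
          using that Cons.prems(1) p by (intro alternates_from_Cons_other) auto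
        then show ?thesis by (auto simp: sorted_wrt_iff_nth_less)
      qed
      moreover have "alternates_from (x # w) x y \<longleftrightarrow> alternates_from w y x" if "y \<in> set q" for y
        using that Cons.prems(1) p by (intro alternates_from_Cons_same) auto
      ultimately show ?thesis
        by (auto simp: p sorted_wrt_append)
    qed
    also have "\<dots> \<longleftrightarrow> w = cycle_word (q @ [x]) (length w)"
      using Cons.prems p by (intro Cons.IH) auto
    finally show ?thesis using True p by simp
  next
    case False
    then have "z \<in> set q" using Cons.prems p by auto
    then have "\<not> sorted_wrt (alternates_from (z # w)) p"
      using False alternates_from_Cons_second[of x z w] by (auto simp: p)
    then show ?thesis using False p by auto
  qed
qed

text \<open>The list \<open>p\<close> contains the letters in the order of their first occurrences.\<close>

lemma ex_first_occurrence_order: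
  "\<exists>p. distinct p \<and> set p = set w \<and> sorted_wrt (\<lambda>x y. hd (filter (\<lambda>z. z = x \<or> z = y) w) = x) p"
proof (induction w)
  case (Cons a w)
  then obtain p where p: "distinct p" "set p = set w"
    "sorted_wrt (\<lambda>x y. hd (filter (\<lambda>z. z = x \<or> z = y) w) = x) p" by blast
  have "sorted_wrt (\<lambda>x y. hd (filter (\<lambda>z. z = x \<or> z = y) w) = x) (filter (\<lambda>x. x \<noteq> a) p)"
    using p(3) by (rule sorted_wrt_filter)
  then have "sorted_wrt (\<lambda>x y. hd (filter (\<lambda>z. z = x \<or> z = y) (a # w)) = x) (filter (\<lambda>x. x \<noteq> a) p)"
    by (rule sorted_wrt_mono_rel[rotated]) auto
  then show ?case
    using p by (intro exI[of _ "a # filter (\<lambda>x. x \<noteq> a) p"]) auto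
qed simp

lemma all_alternate_iff_cycle_word:
  "(\<forall>x\<in>set w. \<forall>y\<in>set w. x \<noteq> y \<longrightarrow> alternate w x y) \<longleftrightarrow>
   (\<exists>p. distinct p \<and> set p = set w \<and> w = cycle_word p (length w))"
proof
  assume alt: "\<forall>x\<in>set w. \<forall>y\<in>set w. x \<noteq> y \<longrightarrow> alternate w x y"
  obtain p where p: "distinct p" "set p = set w"
    "sorted_wrt (\<lambda>x y. hd (filter (\<lambda>z. z = x \<or> z = y) w) = x) p"
    using ex_first_occurrence_order[of w] by blast
  have "sorted_wrt (alternates_from w) p"
    unfolding sorted_wrt_iff_nth_less
  proof (intro allI impI)
    fix i j assume ij: "i < j" "j < length p"
    define x y u where "x = p ! i" "y = p ! j" "u = filter (\<lambda>z. z = x \<or> z = y) w"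
    have xy: "x \<noteq> y" "x \<in> set w" "y \<in> set w"
      using ij p(1,2) nth_eq_iff_index_eq[of p i j] by (auto simp: x_y_u_def simp flip: p(2))
    then obtain k where k: "u = alt_word x y k \<or> u = alt_word y x k"
      using alt by (auto simp: alternate_def x_y_u_def)
    have "hd u = x" using p(3) ij by (auto simp: x_y_u_def sorted_wrt_iff_nth_less)
    moreover have "u \<noteq> []" using xy by (auto simp: x_y_u_def filter_empty_conv)
    ultimately have "u \<noteq> alt_word y x k" using xy(1) by (cases k) (auto dest: arg_cong[of _ _ hd])
    then have "u = alt_word x y k" using k by blast
    then show "alternates_from w (p ! i) (p ! j)"
      by (auto simp: x_y_u_def alternates_from_def)
  qed
  then show "\<exists>p. distinct p \<and> set p = set w \<and> w = cycle_word p (length w)"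
    using p sorted_wrt_alternates_from_iff[of p w] by auto
next
  assume "\<exists>p. distinct p \<and> set p = set w \<and> w = cycle_word p (length w)"
  then obtain p where p: "distinct p" "set p = set w" "sorted_wrt (alternates_from w) p"
    using sorted_wrt_alternates_from_iff by (metis order_refl)
  show "\<forall>x\<in>set w. \<forall>y\<in>set w. x \<noteq> y \<longrightarrow> alternate w x y"
  proof (intro ballI impI)
    fix x y assume xy: "x \<in> set w" "y \<in> set w" "x \<noteq> y"
    then obtain i j where ij: "i < length p" "j < length p" "x = p ! i" "y = p ! j"
      by (metis in_set_conv_nth p(2))
    then have "alternates_from w x y \<or> alternates_from w y x"
      using p(3) xy by (cases i j rule: linorder_cases) (auto simp: sorted_wrt_iff_nth_less)
    then show "alternate w x y"
      using xy by (auto simp: alternates_from_def alternate_def disj_commute)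
  qed
qed

text \<open>The parameter \<open>j\<close> counts the letters beyond the first period, so that
  \<open>extendable n j\<close> indexes the representants of length \<open>n + j\<close>.\<close>

definition extendable :: "nat \<Rightarrow> nat \<Rightarrow> nat list set" where
  "extendable n j = {p. distinct p \<and> set p = {1..n} \<and> avoids_132 (p @ cycle_word p j)}"

lemma representants_K:
  assumes "n \<ge> 1"
  shows "representants_132 (K_verts n) (K_edges n) = (\<Union>j. (\<lambda>p. p @ cycle_word p j) ` extendable n j)"
proof (intro equalityI subsetI)
  fix w assume "w \<in> representants_132 (K_verts n) (K_edges n)"
  then have w: "avoids_132 w" "set w = {1..n}" "\<forall>x\<in>set w. \<forall>y\<in>set w. x \<noteq> y \<longrightarrow> alternate w x y"
    by (auto simp: representants_132_def represents_def K_verts_def K_edges_def)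
  then obtain p where p: "distinct p" "set p = {1..n}" "w = cycle_word p (length w)"
    using all_alternate_iff_cycle_word by metis
  have "length p \<le> length w"
    using p(1,2) w(2) card_length[of w] distinct_card[of p] by simp
  then have "w = p @ cycle_word p (length w - length p)"
    using cycle_word_ge[of p "length w - length p"] p(3) by simp
  moreover from this have "p \<in> extendable n (length w - length p)"
    using p(1,2) w(1) by (simp add: extendable_def)
  ultimately show "w \<in> (\<Union>j. (\<lambda>p. p @ cycle_word p j) ` extendable n j)"
    by blast
next
  fix w assume "w \<in> (\<Union>j. (\<lambda>p. p @ cycle_word p j) ` extendable n j)"
  then obtain p j where p: "distinct p" "set p = {1..n}" "avoids_132 w" "w = p @ cycle_word p j"
    by (auto simp: extendable_def)
  have "p \<noteq> []" using p(2) assms by auto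
  then have set: "set w = set p" using p(4) set_cycle_word[of p j] by auto
  have "w = cycle_word p (length w)" using p(4) cycle_word_ge[of p j] by simp
  then have "\<forall>x\<in>set w. \<forall>y\<in>set w. x \<noteq> y \<longrightarrow> alternate w x y"
    using all_alternate_iff_cycle_word[of w] p(1) set by metis
  then show "w \<in> representants_132 (K_verts n) (K_edges n)"
    using p(2,3) set by (auto simp: representants_132_def represents_def K_verts_def K_edges_def)
qed

section \<open>Counting the representants of a complete graph\<close>

lemma cycle_word_Suc_snoc: "\<exists>x. cycle_word p (Suc j) = cycle_word p j @ [x]"
proof (induction j arbitrary: p)
  case (Suc j)
  then show ?case by (metis append_Cons cycle_word.simps(2))
qed simp

lemma extendable_Suc_subset: "extendable n (Suc j) \<subseteq> extendable n j"
proof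
  fix p assume p: "p \<in> extendable n (Suc j)"
  obtain x where "cycle_word p (Suc j) = cycle_word p j @ [x]"
    using cycle_word_Suc_snoc[of p j] by blast
  then have "avoids_132 ((p @ cycle_word p j) @ [x])"
    using p by (simp add: extendable_def del: cycle_word.simps)
  then have "avoids_132 (p @ cycle_word p j)" by (rule avoids_132_appendD)
  then show "p \<in> extendable n j"
    using p by (simp add: extendable_def)
qed

lemma split_at_threshold:
  fixes y :: "'a :: linorder"
  assumes "sorted_wrt (\<lambda>a b. \<not> (a < y \<and> y < b)) q" "y \<notin> set q"
  shows "q = filter (\<lambda>z. y < z) q @ filter (\<lambda>z. z < y) q"
  using assms
proof (induction q)
  case (Cons a q)
  show ?case
  proof (cases "y < a")
    case True
    with Cons show ?thesis by auto
  next
    case False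
    then have "a < y" using Cons.prems(2) by auto
    then have "\<forall>b\<in>set q. b < y"
      using Cons.prems by (metis linorder_neqE list.set_intros(2) sorted_wrt.simps(2))
    then have "filter (\<lambda>z. y < z) q = []" "filter (\<lambda>z. z < y) q = q"
      by (auto simp: filter_empty_conv intro!: filter_True)
    then show ?thesis using \<open>a < y\<close> by simp
  qed
qed simp

lemma sorted_filter_greater:
  fixes x :: "'a :: linorder"
  assumes "sorted_wrt (\<lambda>b c. \<not> (x < c \<and> c < b)) q"
  shows "sorted (filter (\<lambda>z. x < z) q)"
  using assms by (induction q) auto

lemma sorted_eq_upt:
  assumes "sorted q" "distinct q" "set q = {a..<b}"
  shows "q = [a..<b]"
  using assms by (intro sorted_distinct_set_unique) auto

lemma extendable_0: "extendable n 0 = avoiders {1..n}"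
  by (simp add: extendable_def avoiders_def)

text \<open>The first letter \<open>k\<close> acts twice: as the smallest letter of a pattern, it forces the
  larger letters to increase; repeated at the end, as the letter of middle size, it forces all larger
  letters to precede all smaller ones.\<close>

lemma extendable_1:
  assumes "n \<ge> 1"
  shows "extendable n 1 = (\<Union>k\<in>{1..n}. (\<lambda>s. [k..<Suc n] @ s) ` avoiders {1..<k})"
proof (intro equalityI subsetI)
  fix p assume p: "p \<in> extendable n 1"
  then have "p \<noteq> []" using assms by (auto simp: extendable_def)
  then obtain k q where pk: "p = k # q" by (cases p) auto
  have k: "k \<in> {1..n}" and dq: "distinct q" "k \<notin> set q" and setq: "set q = {1..n} - {k}"
    using p pk by (auto simp: extendable_def)
  have av: "avoids_132 (k # q @ [k])" using p pk by (simp add: extendable_def)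
  then have avq: "avoids_132 q"
    and "sorted_wrt (\<lambda>a b. \<not> (a < k \<and> k < b)) q"
    and "sorted_wrt (\<lambda>b c. \<not> (k < c \<and> c < b)) q"
    by (auto simp: avoids_132_Cons avoids_132_snoc sorted_wrt_append)
  then have q: "q = filter (\<lambda>z. k < z) q @ filter (\<lambda>z. z < k) q" and srt: "sorted (filter (\<lambda>z. k < z) q)"
    using dq split_at_threshold sorted_filter_greater by blast+
  have "set (filter (\<lambda>z. k < z) q) = {z \<in> {1..n} - {k}. k < z}"
    by (simp only: set_filter setq)
  also have "\<dots> = {Suc k..<Suc n}" by auto
  finally have "filter (\<lambda>z. k < z) q = [Suc k..<Suc n]"
    using srt dq(1) by (intro sorted_eq_upt distinct_filter)
  then have "p = [k..<Suc n] @ filter (\<lambda>z. z < k) q"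
    using pk k q by (metis append_Cons atLeastAtMost_iff less_Suc_eq_le upt_conv_Cons)
  moreover have "avoids_132 (filter (\<lambda>z. z < k) q)"
    using avq q avoids_132_appendD2 by metis
  moreover have "set (filter (\<lambda>z. z < k) q) = {1..<k}"
  proof -
    have "set (filter (\<lambda>z. z < k) q) = {z \<in> {1..n} - {k}. z < k}"
      by (simp only: set_filter setq)
    also have "\<dots> = {1..<k}" using k by auto
    finally show ?thesis .
  qed
  ultimately have "p = [k..<Suc n] @ filter (\<lambda>z. z < k) q" "filter (\<lambda>z. z < k) q \<in> avoiders {1..<k}"
    using dq(1) by (auto simp: avoiders_def)
  then show "p \<in> (\<Union>k\<in>{1..n}. (\<lambda>s. [k..<Suc n] @ s) ` avoiders {1..<k})"
    using k by blast
next
  fix p assume "p \<in> (\<Union>k\<in>{1..n}. (\<lambda>s. [k..<Suc n] @ s) ` avoiders {1..<k})"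
  then obtain k s where k: "k \<in> {1..n}" and s: "s \<in> avoiders {1..<k}" and p: "p = [k..<Suc n] @ s"
    by blast
  have "avoids_132 p"
    unfolding p using s k
    by (subst avoids_132_append_descending) (auto simp: avoiders_def avoids_132_sorted simp del: upt_Suc)
  moreover have "sorted_wrt (\<lambda>a b. \<not> (a < k \<and> k < b)) p"
  proof -
    have "\<forall>a\<in>set [k..<Suc n]. k \<le> a" "\<forall>b\<in>set s. b < k"
      using s by (auto simp: avoiders_def)
    then have "sorted_wrt (\<lambda>a b. \<not> (a < k \<and> k < b)) [k..<Suc n]"
      "sorted_wrt (\<lambda>a b. \<not> (a < k \<and> k < b)) s"
      by (auto simp: sorted_wrt_iff_nth_less simp del: upt_Suc dest: nth_mem)
        (meson nth_mem not_less_iff_gr_or_eq order.strict_trans)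
    moreover have "\<forall>a\<in>set [k..<Suc n]. \<forall>b\<in>set s. \<not> (a < k \<and> k < b)"
      by (auto simp del: upt_Suc)
    ultimately show ?thesis
      unfolding p sorted_wrt_append by blast
  qed
  moreover have "cycle_word p 1 = [k]"
    using k by (simp add: p upt_conv_Cons del: upt_Suc)
  ultimately show "p \<in> extendable n 1"
    using s k p by (auto simp: extendable_def avoids_132_snoc avoiders_def)
qed

text \<open>The head of \<open>s\<close> reappears after \<open>b\<close>, which is larger than all of \<open>s\<close>. Were it not 1, the
  letters 1, \<open>b\<close> and that repetition would form 132. And once \<open>s\<close> starts with 1, avoidance makes
  the rest increase.\<close>

lemma increasing_if_head_repeated:
  assumes "avoids_132 (u @ s @ v @ [hd s])" "s \<in> avoiders {1..<k}" "b \<in> set v" "k \<le> b" "2 \<le> k"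
  shows "s = [1..<k]"
proof -
  have "1 \<in> set s" using assms by (auto simp: avoiders_def)
  then obtain s1 s2 where s: "s = s1 @ 1 # s2" by (meson split_list)
  obtain v1 v2 where v: "v = v1 @ b # v2" using assms(3) by (meson split_list)
  have "s \<noteq> []" using s by simp
  then have hd: "hd s \<in> {1..<k}" using assms(2) by (auto simp: avoiders_def)
  have "hd s = 1"
  proof (rule ccontr)
    assume "hd s \<noteq> 1"
    then have "1 < hd s" "hd s < b" using hd assms(4) by auto
    then show False
      using not_avoids_132[of 1 "hd s" b _ "u @ s1" "s2 @ v1" v2] assms(1) s v by simp
  qed
  then obtain t where t: "s = 1 # t" using \<open>s \<noteq> []\<close> by (cases s) auto
  then have "distinct t" and "avoids_132 (1 # t)" and "insert 1 (set t) = {1..<k}" and "1 \<notin> set t"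
    using assms(2) by (simp_all add: avoiders_def)
  have "set t = insert 1 (set t) - {1}" using \<open>1 \<notin> set t\<close> by blast
  also have "\<dots> = {1..<k} - {1}" by (simp only: \<open>insert 1 (set t) = {1..<k}\<close>)
  also have "\<dots> = {Suc 1..<k}" by auto
  finally have "set t = {Suc 1..<k}" .
  then have "filter (\<lambda>z. 1 < z) t = t" by (simp add: filter_id_conv)
  moreover have "sorted (filter (\<lambda>z. 1 < z) t)"
    using \<open>avoids_132 (1 # t)\<close> by (intro sorted_filter_greater) (simp add: avoids_132_Cons)
  ultimately have "t = [Suc 1..<k]"
    using \<open>set t = {Suc 1..<k}\<close> \<open>distinct t\<close> by (intro sorted_eq_upt) simp_all
  then show ?thesis using t assms(5) by (simp add: upt_conv_Cons)
qed

text \<open>The added letters are \<open>k\<close> and its successor in \<open>p = k (k+1) \<dots> n s\<close>. For \<open>k = n\<close> the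
  successor is the head of \<open>s\<close>, and the repeated \<open>n\<close> before it forces \<open>s\<close> to increase. For
  \<open>k = n - 1\<close> the successor is \<open>n\<close>, which as a last letter never completes a pattern.\<close>

lemma extendable_2:
  assumes "n \<ge> 3"
  shows "extendable n 2 = (\<lambda>s. (n - 1) # n # s) ` avoiders {1..<n - 1} \<union> {n # [1..<n]}"
proof (intro equalityI subsetI)
  fix p assume p: "p \<in> extendable n 2"
  then have "p \<in> extendable n 1"
    using extendable_Suc_subset[of n 1] by (auto simp: numeral_2_eq_2)
  then obtain k s where k: "1 \<le> k" "k \<le> n" and s: "s \<in> avoiders {1..<k}" and pk: "p = [k..<Suc n] @ s"
    using extendable_1[of n] assms by auto
  have av: "avoids_132 (p @ cycle_word p 2)" using p by (simp add: extendable_def)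
  consider "k = n" | "k = n - 1" | "k + 2 \<le> n" using k by linarith
  then show "p \<in> (\<lambda>s. (n - 1) # n # s) ` avoiders {1..<n - 1} \<union> {n # [1..<n]}"
  proof cases
    case 1
    then have p': "p = n # s" using pk by simp
    have "s \<noteq> []" using s 1 assms by (auto simp: avoiders_def)
    then have "cycle_word p 2 = [n, hd s]" by (simp add: p' numeral_2_eq_2)
    then have "avoids_132 ([n] @ s @ [n] @ [hd s])" using av p' by simp
    then have "s = [1..<n]"
      using s assms 1 by (intro increasing_if_head_repeated[of "[n]" s "[n]" n n]) auto
    then show ?thesis using p' by simp
  next
    case 2
    then have "[k..<Suc n] = [n - 1, n]" using assms by (simp add: upt_conv_Cons)
    then show ?thesis using pk s 2 by simp
  next
    case 3
    then have "[k..<Suc n] = k # (k + 1) # (k + 2) # [k + 3..<Suc n]"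
      by (simp add: upt_conv_Cons eval_nat_numeral del: upt_Suc)
    then have p': "p = k # (k + 1) # (k + 2) # [k + 3..<Suc n] @ s" using pk by simp
    then have "cycle_word p 2 = [k, k + 1]" by (simp add: numeral_2_eq_2)
    then show ?thesis
      using av not_avoids_132[of k "k + 1" "k + 2" "p @ cycle_word p 2" "[]" "[k + 1]" "[k + 3..<Suc n] @ s @ [k]"] p'
      by simp
  qed
next
  fix p assume "p \<in> (\<lambda>s. (n - 1) # n # s) ` avoiders {1..<n - 1} \<union> {n # [1..<n]}"
  then consider s where "p = (n - 1) # n # s" "s \<in> avoiders {1..<n - 1}" | "p = n # [1..<n]"
    by blast
  then show "p \<in> extendable n 2"
  proof cases
    case 1
    then have p': "p = [n - 1..<Suc n] @ s" using assms by (simp add: upt_conv_Cons)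
    moreover have "n - 1 \<in> {1..n}" "n \<ge> 1" using assms by auto
    ultimately have "p \<in> extendable n 1" using 1(2) extendable_1[of n] by blast
    then have ext: "distinct p" "set p = {1..n}" "avoids_132 (p @ [n - 1])"
      using 1 by (auto simp: extendable_def)
    then have "avoids_132 ((p @ [n - 1]) @ [n])"
      by (intro avoids_132_snoc_extremal[of "p @ [n - 1]"]) auto
    then show ?thesis using 1 ext by (simp add: extendable_def numeral_2_eq_2)
  next
    case 2
    have "cycle_word p 2 = [n, 1]" using assms by (simp add: 2 numeral_2_eq_2 upt_conv_Cons)
    have "avoids_132 ([n] @ ([1..<n] @ [n]) @ [1])"
    proof -
      have "avoids_132 ([n] @ [1..<Suc n])"
        using assms by (subst avoids_132_append_descending) (auto simp: avoids_132_sorted simp del: upt_Suc)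
      then have "avoids_132 (([n] @ [1..<Suc n]) @ [1])"
        using assms by (intro avoids_132_snoc_extremal[of "[n] @ [1..<Suc n]"]) (auto simp del: upt_Suc)
      then show ?thesis using assms by simp
    qed
    then have "avoids_132 (p @ cycle_word p 2)"
      using 2 \<open>cycle_word p 2 = _\<close> by simp
    then show ?thesis using assms 2 by (auto simp: extendable_def)
  qed
qed

text \<open>The third added letter is 2 for \<open>p = n 1 2 \<dots>\<close>, completing the pattern \<open>1 n 2\<close>. For
  \<open>p = (n-1) n s\<close> it is the head of \<open>s\<close>, after the repeated \<open>n\<close>.\<close>

lemma extendable_3:
  assumes "n \<ge> 3"
  shows "extendable n 3 = {(n - 1) # n # [1..<n - 1]}"
proof (intro equalityI subsetI)
  fix p assume p: "p \<in> extendable n 3"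
  then have "p \<in> extendable n 2"
    using extendable_Suc_subset[of n 2] by (auto simp: eval_nat_numeral)
  then consider s where "p = (n - 1) # n # s" "s \<in> avoiders {1..<n - 1}" | "p = n # [1..<n]"
    using extendable_2[OF assms] by blast
  moreover have av: "avoids_132 (p @ cycle_word p 3)" using p by (simp add: extendable_def)
  ultimately show "p \<in> {(n - 1) # n # [1..<n - 1]}"
  proof cases
    case 1
    have "s \<noteq> []" using 1 assms by (auto simp: avoiders_def)
    then have "cycle_word p 3 = [n - 1, n, hd s]" by (simp add: 1 eval_nat_numeral)
    then have "avoids_132 ([n - 1, n] @ s @ [n - 1, n] @ [hd s])" using av 1 by simp
    then have "s = [1..<n - 1]"
      using 1 assms by (intro increasing_if_head_repeated[of "[n - 1, n]" s "[n - 1, n]" "n - 1" n]) auto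
    then show ?thesis using 1 by simp
  next
    case 2
    then have p': "p = n # 1 # 2 # [3..<n]"
      using assms by (simp add: upt_conv_Cons eval_nat_numeral)
    then have "cycle_word p 3 = [n, 1, 2]" by (simp add: eval_nat_numeral)
    then show ?thesis
      using av not_avoids_132[of 1 2 n "p @ cycle_word p 3" "[n]" "2 # [3..<n]" "[1]"] p' assms by simp
  qed
next
  fix p assume "p \<in> {(n - 1) # n # [1..<n - 1]}"
  then have p: "p = (n - 1) # n # [1..<n - 1]" by simp
  have "p \<in> extendable n 2"
    unfolding extendable_2[OF assms] p by (auto simp: avoiders_def avoids_132_sorted)
  then have ext: "distinct p" "set p = {1..n}" "avoids_132 (p @ [n - 1, n])"
    by (auto simp: extendable_def p numeral_2_eq_2)
  have "avoids_132 ((p @ [n - 1, n]) @ [1])"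
    using ext(2,3) assms by (intro avoids_132_snoc_extremal[of "p @ [n - 1, n]"]) auto
  moreover have "cycle_word p 3 = [n - 1, n, 1]"
    using assms by (simp add: p eval_nat_numeral upt_conv_Cons)
  ultimately show "p \<in> extendable n 3"
    using ext by (simp add: extendable_def)
qed

text \<open>The fourth added letter is 2 and again completes \<open>1 n 2\<close>.\<close>

lemma extendable_ge_4_empty:
  assumes "n \<ge> 3" "j \<ge> 4"
  shows "extendable n j = {}"
  using assms(2)
proof (induction j rule: dec_induct)
  case base
  show ?case
  proof (rule ccontr)
    assume "extendable n 4 \<noteq> {}"
    then obtain p where p4: "p \<in> extendable n 4" by blast
    then have "p \<in> extendable n 3"
      using extendable_Suc_subset[of n 3] by (auto simp: eval_nat_numeral)
    then have p: "p = (n - 1) # n # 1 # [2..<n - 1]"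
      using assms(1) by (simp add: extendable_3 upt_conv_Cons numeral_2_eq_2)
    \<comment> \<open>For \<open>n = 3\<close> the period is used up after three letters, and the 2 is the letter \<open>n - 1\<close>.\<close>
    have "cycle_word p 4 = [n - 1, n, 1, 2]"
      by (cases "n = 3") (use assms(1) in \<open>simp_all add: p eval_nat_numeral upt_conv_Cons\<close>)
    then have "\<not> avoids_132 (p @ cycle_word p 4)"
      using assms(1) p by (intro not_avoids_132[of 1 2 n _ "[n - 1, n]" "[2..<n - 1] @ [n - 1]" "[1]"]) auto
    then show False using p4 by (simp add: extendable_def)
  qed
next
  case (step j)
  then show ?case using extendable_Suc_subset[of n j] by blast
qed

lemma finite_extendable: "finite (extendable n j)"
  by (rule finite_subset[OF _ finite_subset_distinct[of "{1..n}"]]) (auto simp: extendable_def)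

lemma card_extendable_1:
  assumes "n \<ge> 1"
  shows "real (card (extendable n 1)) = (\<Sum>i<n. catalan i)"
proof -
  let ?A = "\<lambda>k. (\<lambda>s. [k..<Suc n] @ s) ` avoiders {1..<k}"
  have "card (extendable n 1) = (\<Sum>k=1..n. card (?A k))"
    unfolding extendable_1[OF assms]
  proof (rule card_UN_disjoint)
    show "\<forall>i\<in>{1..n}. \<forall>j\<in>{1..n}. i \<noteq> j \<longrightarrow> ?A i \<inter> ?A j = {}"
    proof (intro ballI impI, rule ccontr)
      fix i j assume "i \<in> {1..n}" "j \<in> {1..n}" "i \<noteq> j" "?A i \<inter> ?A j \<noteq> {}"
      then obtain s t where "[i..<Suc n] @ s = [j..<Suc n] @ t" by blast
      then have "hd ([i..<Suc n] @ s) = hd ([j..<Suc n] @ t)" by simp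
      with \<open>i \<in> _\<close> \<open>j \<in> _\<close> \<open>i \<noteq> j\<close> show False by (simp add: upt_conv_Cons del: upt_Suc)
    qed
  qed (auto intro: finite_avoiders)
  also have "real \<dots> = (\<Sum>k=1..n. catalan (k - 1))"
    unfolding of_nat_sum
  proof (rule sum.cong)
    fix k assume k: "k \<in> {1..n}"
    have "card (?A k) = card (avoiders {1..<k})" by (intro card_image) (simp add: inj_on_def)
    then show "real (card (?A k)) = catalan (k - 1)"
      using card_avoiders_interval[of 1 "k - 1"] k by simp
  qed simp
  also have "\<dots> = (\<Sum>i<n. catalan i)"
    by (simp add: sum.atLeast1_atMost_eq)
  finally show ?thesis .
qed

lemma card_extendable_2:
  assumes "n \<ge> 3"
  shows "real (card (extendable n 2)) = catalan (n - 2) + 1"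
proof -
  let ?A = "(\<lambda>s. (n - 1) # n # s) ` avoiders {1..<n - 1}"
  have "card (extendable n 2) = card ?A + 1"
    using assms unfolding extendable_2[OF assms]
    by (subst card_Un_disjoint) (auto intro: finite_avoiders)
  also have "card ?A = card (avoiders {1..<n - 1})"
    by (intro card_image) (simp add: inj_on_def)
  also have "real (\<dots> + 1) = catalan (n - 2) + 1"
  proof -
    have "1 + (n - 2) = n - 1" using assms by simp
    then show ?thesis using card_avoiders_interval[of 1 "n - 2"] by simp
  qed
  finally show ?thesis .
qed

lemma card_representants_K:
  assumes "n \<ge> 3"
  shows "finite (representants_132 (K_verts n) (K_edges n)) \<and>
    real (card (representants_132 (K_verts n) (K_edges n))) = 2 + catalan (n - 2) + (\<Sum>i=0..n. catalan i)"
proof -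
  let ?f = "\<lambda>j p. p @ cycle_word p j"
  have len: "length p = n" if "p \<in> extendable n j" for p j
    using that distinct_card[of p] by (auto simp: extendable_def)
  have "representants_132 (K_verts n) (K_edges n) = (\<Union>j. ?f j ` extendable n j)"
    using assms by (intro representants_K) simp
  also have "\<dots> = (\<Union>j\<in>{..<4}. ?f j ` extendable n j)"
  proof -
    have "extendable n j = {}" if "j \<notin> {..<4}" for j
      using extendable_ge_4_empty[OF assms, of j] that by simp
    then show ?thesis by blast
  qed
  finally have eq: "representants_132 (K_verts n) (K_edges n) = (\<Union>j\<in>{..<4}. ?f j ` extendable n j)" .
  have "card (\<Union>j\<in>{..<4}. ?f j ` extendable n j) = (\<Sum>j<4. card (?f j ` extendable n j))"
  proof (rule card_UN_disjoint)
    show "\<forall>i\<in>{..<4}. \<forall>j\<in>{..<4}. i \<noteq> j \<longrightarrow> ?f i ` extendable n i \<inter> ?f j ` extendable n j = {}"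
    proof (intro ballI impI, rule ccontr)
      fix i j :: nat assume "i \<noteq> j" "?f i ` extendable n i \<inter> ?f j ` extendable n j \<noteq> {}"
      then obtain p q where pq: "p \<in> extendable n i" "q \<in> extendable n j" "?f i p = ?f j q" by blast
      then have "length (?f i p) = length (?f j q)" by simp
      then show False using \<open>i \<noteq> j\<close> len[OF pq(1)] len[OF pq(2)] by simp
    qed
  qed (auto intro: finite_extendable)
  also have "\<dots> = (\<Sum>j<4. card (extendable n j))"
    by (intro sum.cong refl card_image) (auto simp: inj_on_def dest: len)
  also have "\<dots> = card (extendable n 0) + card (extendable n 1) + card (extendable n 2) + card (extendable n 3)"
    by (simp add: eval_nat_numeral)
  also have "real \<dots> = catalan n + (\<Sum>i<n. catalan i) + (catalan (n - 2) + 1) + 1"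
  proof -
    have "{1..n} = {1..<1 + n}" by auto
    then have "real (card (extendable n 0)) = catalan n"
      unfolding extendable_0 by (simp only: card_avoiders_interval)
    moreover have "card (extendable n 3) = 1"
      by (simp add: extendable_3[OF assms])
    ultimately show ?thesis
      using card_extendable_1[of n] card_extendable_2[OF assms] assms by simp
  qed
  also have "\<dots> = 2 + catalan (n - 2) + (\<Sum>i=0..n. catalan i)"
    by (simp add: atLeast0AtMost lessThan_Suc_atMost[symmetric])
  finally show ?thesis
    unfolding eq by (simp add: finite_extendable)
qed

section \<open>Representability and the two smallest graphs\<close>

lemma representable_K:
  assumes "n \<ge> 1"
  shows "representable_132 (K_verts n) (K_edges n)"
proof -
  have "[1..<Suc n] \<in> extendable n 0"
    unfolding extendable_0 by (auto simp: avoiders_def avoids_132_sorted simp del: upt_Suc)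
  then have "representants_132 (K_verts n) (K_edges n) \<noteq> {}"
    unfolding representants_K[OF assms] by blast
  then show ?thesis
    unfolding representable_132_def
    by (intro conjI simple_graph_K exI[of _ "\<lambda>x. x"]) (simp_all add: map_prod.id[unfolded id_def])
qed

lemma avoids_132_two_letters:
  assumes "set w \<subseteq> {x, y}"
  shows "avoids_132 w"
  unfolding avoids_132_def
proof safe
  fix i j k assume "i < j" "j < k" "k < length w" and less: "w ! i < w ! k" "w ! k < w ! j"
  then have "{w ! i, w ! j, w ! k} \<subseteq> set w" by simp
  then have "{w ! i, w ! j, w ! k} \<subseteq> {x, y}" using assms by blast
  with less show False by auto
qed

lemma representants_K_small:
  assumes "n \<ge> 1" "n \<le> 2"
  shows "representants_132 (K_verts n) (K_edges n) =
    {cycle_word p m |p m. distinct p \<and> set p = {1..n} \<and> n \<le> m}"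
proof -
  have "avoids_132 (p @ cycle_word p j)" if "set p = {1..n}" for p j
  proof (rule avoids_132_two_letters[of _ 1 2])
    have "p \<noteq> []" using that assms by auto
    moreover have "{1..n} \<subseteq> {1, 2}" using assms by auto
    ultimately show "set (p @ cycle_word p j) \<subseteq> {1, 2}"
      using set_cycle_word[of p j] that by auto
  qed
  then have ext: "extendable n j = {p. distinct p \<and> set p = {1..n}}" for j
    by (auto simp: extendable_def)
  have len: "length p = n" if "distinct p" "set p = {1..n}" for p
    using that distinct_card[of p] by simp
  show ?thesis
    unfolding representants_K[OF assms(1)] ext
  proof (intro equalityI subsetI)
    fix w assume "w \<in> (\<Union>j. (\<lambda>p. p @ cycle_word p j) ` {p. distinct p \<and> set p = {1..n}})"
    then obtain p j where "distinct p" "set p = {1..n}" "w = cycle_word p (n + j)"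
      by (auto simp: cycle_word_ge len simp flip: cycle_word_ge)
    then show "w \<in> {cycle_word p m |p m. distinct p \<and> set p = {1..n} \<and> n \<le> m}"
      by (intro CollectI exI[of _ p] exI[of _ "n + j"]) simp
  next
    fix w assume "w \<in> {cycle_word p m |p m. distinct p \<and> set p = {1..n} \<and> n \<le> m}"
    then obtain p m where p: "distinct p" "set p = {1..n}" "n \<le> m" "w = cycle_word p m" by blast
    then have "w = p @ cycle_word p (m - n)"
      using cycle_word_ge[of p "m - n"] len[of p] by simp
    then show "w \<in> (\<Union>j. (\<lambda>p. p @ cycle_word p j) ` {p. distinct p \<and> set p = {1..n}})"
      using p by blast
  qed
qed

lemma cycle_word_singleton: "cycle_word [x] m = replicate m x"
  by (induction m) auto

lemma cycle_word_pair: "cycle_word [x, y] m = alt_word x y m"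
  by (induction m arbitrary: x y) auto

lemma representants_K1:
  "representants_132 (K_verts 1) (K_edges 1) = {replicate k 1 |k. k \<ge> 1}"
proof -
  have "distinct p \<and> set p = {1..1} \<longleftrightarrow> p = [1]" for p :: "nat list"
  proof
    assume p: "distinct p \<and> set p = {1..1}"
    then have "length p = 1" using distinct_card[of p] by simp
    then obtain x where "p = [x]" by (metis One_nat_def length_0_conv length_Suc_conv)
    then show "p = [1]" using p by simp
  qed simp
  then have "representants_132 (K_verts 1) (K_edges 1) = {cycle_word p m |p m. p = [1] \<and> 1 \<le> m}"
    by (subst representants_K_small) (simp_all only: flip: conj_assoc)
  then show ?thesis
    by (simp flip: cycle_word_singleton)
qed

lemma representants_K2:
  "representants_132 (K_verts 2) (K_edges 2) =
    {alt_word 1 2 k |k. k \<ge> 2} \<union> {alt_word 2 1 k |k. k \<ge> 2}"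
proof -
  have two: "{1..2} = {1, 2 :: nat}" by auto
  have "distinct p \<and> set p = {1..2} \<longleftrightarrow> p = [1, 2] \<or> p = [2, 1]" for p :: "nat list"
  proof
    assume p: "distinct p \<and> set p = {1..2}"
    then have "length p = 2" using distinct_card[of p] by simp
    then obtain x y where "p = [x, y]"
      by (metis (no_types, lifting) Suc_1 One_nat_def length_0_conv length_Suc_conv)
    moreover have "{x, y} = {1, 2}" using p two \<open>p = [x, y]\<close> by simp
    ultimately show "p = [1, 2] \<or> p = [2, 1]" by (auto simp: doubleton_eq_iff)
  qed (auto simp: two)
  then have "representants_132 (K_verts 2) (K_edges 2) =
      {cycle_word p m |p m. (p = [1, 2] \<or> p = [2, 1]) \<and> 2 \<le> m}"
    by (subst representants_K_small) (simp_all flip: conj_assoc)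
  also have "\<dots> = {cycle_word [1, 2] m |m. 2 \<le> m} \<union> {cycle_word [2, 1] m |m. 2 \<le> m}"
    by blast
  finally show ?thesis
    by (simp only: cycle_word_pair)
qed

theorem theorem4p5:
  shows "(\<forall>n::nat. n \<ge> 1 \<longrightarrow> representable_132 (K_verts n) (K_edges n)) \<and>
    (\<forall>n::nat. n \<ge> 3 \<longrightarrow>
       finite (representants_132 (K_verts n) (K_edges n)) \<and>
       real (card (representants_132 (K_verts n) (K_edges n)))
         = 2 + catalan (n - 2) + (\<Sum>i=0..n. catalan i)) \<and>
    representants_132 (K_verts 1) (K_edges 1) = {replicate k 1 |k. k \<ge> 1} \<and>
    representants_132 (K_verts 2) (K_edges 2)
      = {alt_word 1 2 k |k. k \<ge> 2} \<union> {alt_word 2 1 k |k. k \<ge> 2}"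
  using representable_K card_representants_K representants_K1 representants_K2 by blast

end
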